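(* Let $M>0$, $q\in\mathbb N^*$, $p\in\{0,\dots,q-1\}$ coprime with $q$, and $t_{M,p,q}=\frac{2\pi}{M^2}\cdot\frac pq$. Then the restriction of the distribution $\sum_{k\in\mathbb Z}e^{-i(Mk)^2t}e^{iMkx}$ to the line $\{t_{M,p,q}\}\times\mathbb R$ satisfies, in $\mathscr D'(\{t_{M,p,q}\}\times\mathbb R,\mathbb C)$, $$\Big(\sum_{k\in\mathbb Z}e^{-i(Mk)^2t}e^{iMkx}\Big)_{|\{t_{M,p,q}\}\times\mathbb R}=\delta(t-t_{M,p,q})\otimes\Big(\sum_{\kappa=0}^{q-1}G(-p,\kappa,q)\Big(\frac{2\pi}{Mq}\sum_{k\in\mathbb Z}\delta\Big(x-\frac{2k\pi}{M}-\frac{2\pi\kappa}{Mq}\Big)\Big)\Big),$$ where $$G(-p,\kappa,q)=\sum_{\ell=0}^{q-1}e^{2i\pi(-p\ell^2+\kappa\ell)/q}.$$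
   Context: $\mathbb N^*$ is the set of positive integers. For $\tau\geq0$, the restriction of $\sum_{k}e^{-i(Mk)^2t}e^{iMkx}$ to $\{\tau\}\times\mathbb R$ is the distribution in $x$ given by the series $\sum_ke^{-i(Mk)^2\tau}e^{iMkx}$, convergent in the sense of distributions on $\mathbb R_x$. The prefactor $\delta(t-t_{M,p,q})\otimes$ only records that the distribution in $x$ lives on the line $\{t_{M,p,q}\}\times\mathbb R$, so the identity is an equality of distributions in $x$ at the time $t=t_{M,p,q}$. *)

theory Defs
  imports "HOL-Analysis.Analysis"
begin

section \<open>Test functions on the real line\<close>

definition nth_deriv :: "nat \<Rightarrow> (real \<Rightarrow> complex) \<Rightarrow> real \<Rightarrow> complex" where
  "nth_deriv n \<phi> = ((\<lambda>g x. vector_derivative g (at x)) ^^ n) \<phi>"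

definition test_functions :: "(real \<Rightarrow> complex) set" where
  "test_functions =
     {\<phi>. (\<forall>n x. nth_deriv n \<phi> differentiable (at x)) \<and> compact (closure {x. \<phi> x \<noteq> 0})}"

lemma nth_deriv_0 [simp]: "nth_deriv 0 \<phi> = \<phi>"
  by (simp add: nth_deriv_def)

lemma nth_deriv_Suc: "nth_deriv (Suc n) \<phi> x = vector_derivative (nth_deriv n \<phi>) (at x)"
  by (simp add: nth_deriv_def)

lemma nth_deriv_lincomb:
  assumes "\<And>n x. nth_deriv n \<phi> differentiable (at x)" "\<And>n x. nth_deriv n \<psi> differentiable (at x)"
  shows "nth_deriv n (\<lambda>x. \<phi> x + c * \<psi> x) = (\<lambda>x. nth_deriv n \<phi> x + c * nth_deriv n \<psi> x)"
proof (induction n)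
  case (Suc n)
  have "vector_derivative (\<lambda>x. nth_deriv n \<phi> x + c * nth_deriv n \<psi> x) (at x)
      = nth_deriv (Suc n) \<phi> x + c * nth_deriv (Suc n) \<psi> x" for x
    unfolding nth_deriv_Suc
    by (intro vector_derivative_at has_vector_derivative_add has_vector_derivative_mult_right
        vector_derivative_works[THEN iffD1] assms)
  then show ?case
    by (simp add: fun_eq_iff nth_deriv_Suc Suc.IH)
qed simp

lemma test_functions_lincomb:
  assumes "\<phi> \<in> test_functions" "\<psi> \<in> test_functions"
  shows "(\<lambda>x. \<phi> x + c * \<psi> x) \<in> test_functions"
proof -
  have d: "\<And>n x. nth_deriv n \<phi> differentiable (at x)" "\<And>n x. nth_deriv n \<psi> differentiable (at x)"
    using assms by (auto simp: test_functions_def)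
  have "closure {x. \<phi> x + c * \<psi> x \<noteq> 0} \<subseteq> closure ({x. \<phi> x \<noteq> 0} \<union> {x. \<psi> x \<noteq> 0})"
    by (rule closure_mono) auto
  then have "compact (closure {x. \<phi> x + c * \<psi> x \<noteq> 0})"
    using assms unfolding test_functions_def closure_Un
    by (metis (mono_tags, lifting) closed_closure compact_Int_closed compact_Un inf.absorb_iff2
        mem_Collect_eq)
  then show ?thesis
    using d by (auto simp: test_functions_def nth_deriv_lincomb[OF d] intro!: derivative_intros)
qed

lemma test_functions_continuous:
  assumes "\<phi> \<in> test_functions"
  shows "continuous_on UNIV \<phi>"
proof -
  have "nth_deriv 0 \<phi> differentiable (at x)" for x
    using assms unfolding test_functions_def by blast
  then show ?thesis
    by (simp add: continuous_at_imp_continuous_on differentiable_imp_continuous_within)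
qed

lemma test_functions_bdd:
  assumes "\<phi> \<in> test_functions"
  shows "bdd_above (range (\<lambda>x. norm (\<phi> x)))"
proof -
  have "compact (\<phi> ` closure {x. \<phi> x \<noteq> 0})"
    using assms test_functions_continuous[OF assms]
    by (intro compact_continuous_image) (auto simp: test_functions_def intro: continuous_on_subset)
  then obtain B where B: "\<And>x. x \<in> closure {x. \<phi> x \<noteq> 0} \<Longrightarrow> norm (\<phi> x) \<le> B"
    by (meson bounded_iff compact_imp_bounded imageI)
  have "norm (\<phi> x) \<le> max B 0" for x
  proof (cases "\<phi> x = 0")
    case False
    then have "x \<in> closure {x. \<phi> x \<noteq> 0}"
      using closure_subset by fastforce
    then show ?thesis
      using B by fastforce
  qed simp
  then show ?thesis
    by (auto intro!: bdd_aboveI2)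
qed

lemma norm_test_function_le:
  assumes "\<phi> \<in> test_functions"
  shows "norm (\<phi> x) \<le> (SUP x. norm (\<phi> x))"
  using cSUP_upper[OF UNIV_I test_functions_bdd[OF assms]] .

lemma nth_deriv_in_test_functions:
  assumes "\<phi> \<in> test_functions"
  shows "nth_deriv n \<phi> \<in> test_functions"
proof -
  have supp: "{x. nth_deriv n \<phi> x \<noteq> 0} \<subseteq> closure {x. \<phi> x \<noteq> 0}" for n
  proof (induction n)
    case 0
    then show ?case by (simp add: closure_subset)
  next
    case (Suc n)
    have "nth_deriv (Suc n) \<phi> x = 0" if x: "x \<in> - closure {x. \<phi> x \<noteq> 0}" for x
    proof -
      have "(nth_deriv n \<phi> has_vector_derivative 0) (at x)"
      proof (rule has_vector_derivative_transform_within_open[of "\<lambda>_. 0"])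
        show "open (- closure {x. \<phi> x \<noteq> 0})" by auto
        show "0 = nth_deriv n \<phi> y" if "y \<in> - closure {x. \<phi> x \<noteq> 0}" for y
          using that Suc.IH by fastforce
      qed (use x in auto)
      then show ?thesis
        by (simp add: nth_deriv_Suc vector_derivative_at)
    qed
    then show ?case by blast
  qed
  have "closure {x. nth_deriv n \<phi> x \<noteq> 0} \<subseteq> closure {x. \<phi> x \<noteq> 0}"
    using closure_mono[OF supp[of n]] by simp
  then have "compact (closure {x. nth_deriv n \<phi> x \<noteq> 0})"
    using assms unfolding test_functions_def
    by (metis (mono_tags, lifting) closed_closure compact_Int_closed inf.absorb_iff2
        mem_Collect_eq)
  moreover have "nth_deriv m (nth_deriv n \<phi>) = nth_deriv (m + n) \<phi>" for m
    by (simp add: nth_deriv_def funpow_add)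
  ultimately show ?thesis
    using assms by (auto simp: test_functions_def)
qed

section \<open>Distributions on the real line\<close>

text \<open>
  Only the values on test functions are meaningful; outside, functionals are normalised to 0,
  so that equality in the type below is equality as functionals on test functions.
  Continuity with respect to the usual LF topology is expressed by the seminorm estimates.
\<close>

typedef distribution =
  "{u :: (real \<Rightarrow> complex) \<Rightarrow> complex.
      (\<forall>\<phi>. \<phi> \<notin> test_functions \<longrightarrow> u \<phi> = 0) \<and>
      (\<forall>\<phi>\<in>test_functions. \<forall>\<psi>\<in>test_functions. \<forall>c. u (\<lambda>x. \<phi> x + c * \<psi> x) = u \<phi> + c * u \<psi>) \<and>
      (\<forall>K. compact K \<longrightarrow> (\<exists>C N. \<forall>\<phi>\<in>test_functions. {x. \<phi> x \<noteq> 0} \<subseteq> K \<longrightarrow>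
         norm (u \<phi>) \<le> C * (\<Sum>n\<le>N. SUP x. norm (nth_deriv n \<phi> x))))}"
  morphisms distr_apply Abs_distribution
  by (rule exI[of _ "\<lambda>_. 0"]) (auto intro!: exI[of _ 0])

setup_lifting type_definition_distribution

lemma distr_eqI: "(\<And>\<phi>. \<phi> \<in> test_functions \<Longrightarrow> distr_apply u \<phi> = distr_apply v \<phi>) \<Longrightarrow> u = v"
  by transfer (metis ext)

lemma seminorm_nonneg:
  assumes "\<phi> \<in> test_functions"
  shows "0 \<le> (SUP x. norm (nth_deriv n \<phi> x))"
  using norm_test_function_le[OF nth_deriv_in_test_functions[OF assms], of n 0] norm_ge_zero
  by (rule order_trans[rotated])

lemma seminorm_estimate_mono:
  assumes "\<phi> \<in> test_functions" "N \<le> N'"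
  shows "C * (\<Sum>n\<le>N. SUP x. norm (nth_deriv n \<phi> x))
    \<le> \<bar>C\<bar> * (\<Sum>n\<le>N'. SUP x. norm (nth_deriv n \<phi> x))"
  by (intro mult_mono sum_mono2 sum_nonneg) (use assms seminorm_nonneg in auto)

instantiation distribution :: ab_group_add
begin

lift_definition zero_distribution :: distribution is "\<lambda>_. 0"
  by (auto intro!: exI[of _ 0])

lift_definition uminus_distribution :: "distribution \<Rightarrow> distribution" is "\<lambda>u \<phi>. - u \<phi>"
  by (simp add: algebra_simps)

lift_definition plus_distribution :: "distribution \<Rightarrow> distribution \<Rightarrow> distribution"
  is "\<lambda>u v \<phi>. u \<phi> + v \<phi>"
proof (intro CollectI conjI allI impI ballI, goal_cases)
  case (3 u v K)
  then obtain C N C' N' where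
    u: "\<And>\<phi>. \<phi> \<in> test_functions \<Longrightarrow> {x. \<phi> x \<noteq> 0} \<subseteq> K \<Longrightarrow>
      norm (u \<phi>) \<le> C * (\<Sum>n\<le>N. SUP x. norm (nth_deriv n \<phi> x))" and
    v: "\<And>\<phi>. \<phi> \<in> test_functions \<Longrightarrow> {x. \<phi> x \<noteq> 0} \<subseteq> K \<Longrightarrow>
      norm (v \<phi>) \<le> C' * (\<Sum>n\<le>N'. SUP x. norm (nth_deriv n \<phi> x))"
    by (smt (verit, best) mem_Collect_eq)
  show ?case
  proof (intro exI[of _ "\<bar>C\<bar> + \<bar>C'\<bar>"] exI[of _ "max N N'"] ballI impI)
    fix \<phi> assume \<phi>: "\<phi> \<in> test_functions" "{x. \<phi> x \<noteq> 0} \<subseteq> K"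
    show "norm (u \<phi> + v \<phi>)
        \<le> (\<bar>C\<bar> + \<bar>C'\<bar>) * (\<Sum>n\<le>max N N'. SUP x. norm (nth_deriv n \<phi> x))"
      using norm_triangle_ineq[of "u \<phi>" "v \<phi>"] u[OF \<phi>] v[OF \<phi>]
        seminorm_estimate_mono[OF \<phi>(1), of N "max N N'" C]
        seminorm_estimate_mono[OF \<phi>(1), of N' "max N N'" C']
      by (simp add: distrib_right)
  qed
qed (auto simp: algebra_simps)

definition minus_distribution :: "distribution \<Rightarrow> distribution \<Rightarrow> distribution" where
  "minus_distribution u v = u + (- v)"

instance
  by standard (transfer; simp add: algebra_simps minus_distribution_def)+

end

lift_definition scale_distr :: "complex \<Rightarrow> distribution \<Rightarrow> distribution" (infixr "*\<^sub>C" 75)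
  is "\<lambda>c u \<phi>. c * u \<phi>"
proof (intro CollectI conjI allI impI ballI, goal_cases)
  case (3 c u K)
  then obtain C N where
    u: "\<And>\<phi>. \<phi> \<in> test_functions \<Longrightarrow> {x. \<phi> x \<noteq> 0} \<subseteq> K \<Longrightarrow>
      norm (u \<phi>) \<le> C * (\<Sum>n\<le>N. SUP x. norm (nth_deriv n \<phi> x))"
    by (smt (verit, best) mem_Collect_eq)
  show ?case
    by (intro exI[of _ "norm c * C"] exI[of _ N])
      (use u in \<open>auto simp: norm_mult mult.assoc intro!: mult_left_mono\<close>)
qed (auto simp: algebra_simps)

text \<open>The weak-* topology (pointwise convergence on test functions).\<close>

instantiation distribution :: t2_space
begin

definition open_distribution :: "distribution set \<Rightarrow> bool" where
  "open_distribution U \<longleftrightarrow> (\<exists>V. open V \<and> U = distr_apply -` V)"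

instance
proof
  show "open (UNIV :: distribution set)"
    unfolding open_distribution_def by (intro exI[of _ UNIV]) auto
  show "open (S \<inter> T)" if "open S" "open T" for S T :: "distribution set"
  proof -
    obtain V W where "open V" "S = distr_apply -` V" "open W" "T = distr_apply -` W"
      using \<open>open S\<close> \<open>open T\<close> unfolding open_distribution_def by blast
    then show ?thesis
      unfolding open_distribution_def by (intro exI[of _ "V \<inter> W"]) auto
  qed
  show "open (\<Union> K)" if "\<forall>S\<in>K. open S" for K :: "distribution set set"
  proof -
    have "\<forall>S\<in>K. \<exists>V. open V \<and> S = distr_apply -` V"
      using that unfolding open_distribution_def .
    from bchoice[OF this] obtain V where V: "\<forall>S\<in>K. open (V S) \<and> S = distr_apply -` V S" ..
    have "(\<Union>S\<in>K. S) = (\<Union>S\<in>K. distr_apply -` V S)"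
      by (rule SUP_cong[OF refl]) (rule conjunct2[OF bspec[OF V]])
    then have "\<Union>K = (\<Union>S\<in>K. distr_apply -` V S)"
      by (simp only: image_ident)
    moreover have "open (\<Union>S\<in>K. V S)"
      using V by (intro open_UN) simp
    ultimately show ?thesis
      unfolding open_distribution_def by (intro exI[of _ "\<Union>S\<in>K. V S"]) (simp add: vimage_UN)
  qed
  fix u v :: distribution
  assume "u \<noteq> v"
  then obtain \<phi> where \<phi>: "distr_apply u \<phi> \<noteq> distr_apply v \<phi>"
    using distr_eqI by blast
  obtain A B where AB: "open A" "open B" "distr_apply u \<phi> \<in> A" "distr_apply v \<phi> \<in> B" "A \<inter> B = {}"
    using hausdorff[OF \<phi>] by auto
  have op: "open ((\<lambda>w. distr_apply w \<phi>) -` X)" if "open X" for X :: "complex set"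
  proof -
    have "open ((\<lambda>w :: (real \<Rightarrow> complex) \<Rightarrow> complex. w \<phi>) -` X)"
      using that continuous_on_product_coordinates by (rule open_vimage)
    moreover have "(\<lambda>w. distr_apply w \<phi>) -` X = distr_apply -` ((\<lambda>w. w \<phi>) -` X)"
      by (simp add: vimage_def)
    ultimately show ?thesis
      unfolding open_distribution_def by blast
  qed
  show "\<exists>U V. open U \<and> open V \<and> u \<in> U \<and> v \<in> V \<and> U \<inter> V = {}"
  proof (intro exI conjI)
    show "open ((\<lambda>w. distr_apply w \<phi>) -` A)" "open ((\<lambda>w. distr_apply w \<phi>) -` B)"
      using AB by (simp_all only: op)
  qed (use AB in auto)
qed

end

lemma tendsto_distribution_iff:
  "(f \<longlongrightarrow> u) F \<longleftrightarrow> (\<forall>\<phi>\<in>test_functions. ((\<lambda>i. distr_apply (f i) \<phi>) \<longlongrightarrow> distr_apply u \<phi>) F)"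
proof -
  have off: "distr_apply w \<phi> = 0" if "\<phi> \<notin> test_functions" for w \<phi>
    using that by transfer auto
  have "(f \<longlongrightarrow> u) F \<longleftrightarrow> ((\<lambda>i. distr_apply (f i)) \<longlongrightarrow> distr_apply u) F"
    unfolding tendsto_def open_distribution_def by auto
  also have "\<dots> \<longleftrightarrow> (\<forall>\<phi>. ((\<lambda>i. distr_apply (f i) \<phi>) \<longlongrightarrow> distr_apply u \<phi>) F)"
    using limitin_componentwise[of "\<lambda>_. euclidean" UNIV "\<lambda>i. distr_apply (f i)" "distr_apply u" F]
    by (simp add: euclidean_product_topology)
  also have "\<dots> \<longleftrightarrow> (\<forall>\<phi>\<in>test_functions. ((\<lambda>i. distr_apply (f i) \<phi>) \<longlongrightarrow> distr_apply u \<phi>) F)"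
  proof -
    have "((\<lambda>i. distr_apply (f i) \<phi>) \<longlongrightarrow> distr_apply u \<phi>) F" if "\<phi> \<notin> test_functions" for \<phi>
      by (simp add: off[OF that])
    then show ?thesis by blast
  qed
  finally show ?thesis .
qed

lemma distr_apply_sum: "distr_apply (sum f A) \<phi> = (\<Sum>i\<in>A. distr_apply (f i) \<phi>)"
proof (induction A rule: infinite_finite_induct)
qed (simp_all add: zero_distribution.rep_eq plus_distribution.rep_eq)

lemma has_sum_distribution_iff:
  "(f has_sum u) A \<longleftrightarrow>
    (\<forall>\<phi>\<in>test_functions. ((\<lambda>i. distr_apply (f i) \<phi>) has_sum distr_apply u \<phi>) A)"
  by (simp add: has_sum_def tendsto_distribution_iff distr_apply_sum)

section \<open>Dirac masses and regular distributions\<close>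

lift_definition dirac :: "real \<Rightarrow> distribution"
  is "\<lambda>a \<phi>. if \<phi> \<in> test_functions then \<phi> a else 0"
proof (intro CollectI conjI allI impI ballI, goal_cases)
  case (3 a K)
  show ?case
    by (intro exI[of _ 1] exI[of _ 0]) (simp add: norm_test_function_le)
qed (simp_all add: test_functions_lincomb)

lemma integrable_mult_test_function:
  assumes f: "\<And>K. compact K \<Longrightarrow> set_integrable lborel K f"
    and \<phi>: "\<phi> \<in> test_functions" and K: "compact K" "{x. \<phi> x \<noteq> 0} \<subseteq> K"
  shows "integrable lborel (\<lambda>x. f x * \<phi> x)"
    and "norm (LINT x|lborel. f x * \<phi> x)
      \<le> (LINT x:K|lborel. norm (f x)) * (SUP x. norm (\<phi> x))"
proof -
  let ?S = "SUP x. norm (\<phi> x)"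
  have fK: "integrable lborel (\<lambda>x. indicator K x *\<^sub>R f x)"
    using f[OF K(1)] by (simp add: set_integrable_def)
  then have meas: "(\<lambda>x. indicator K x *\<^sub>R f x) \<in> borel_measurable lborel"
    by (rule borel_measurable_integrable)
  have \<phi>m: "\<phi> \<in> borel_measurable lborel"
    using borel_measurable_continuous_onI[OF test_functions_continuous[OF \<phi>]] by simp
  have eq: "(\<lambda>x. f x * \<phi> x) = (\<lambda>x. (indicator K x *\<^sub>R f x) * \<phi> x)"
  proof
    show "f x * \<phi> x = (indicator K x *\<^sub>R f x) * \<phi> x" for x
      using K(2) by (cases "x \<in> K") auto
  qed
  have nK: "integrable lborel (\<lambda>x. indicator K x *\<^sub>R norm (f x))"
    using integrable_norm[OF fK] by simp
  then have int: "integrable lborel (\<lambda>x. (indicator K x *\<^sub>R norm (f x)) * ?S)"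
    by (rule integrable_mult_left)
  have bd: "norm (f x * \<phi> x) \<le> (indicator K x *\<^sub>R norm (f x)) * ?S" for x
  proof -
    have "norm (f x * \<phi> x) = (indicator K x *\<^sub>R norm (f x)) * norm (\<phi> x)"
      by (subst eq[THEN fun_cong]) (simp add: norm_mult)
    also have "\<dots> \<le> (indicator K x *\<^sub>R norm (f x)) * ?S"
      by (intro mult_left_mono norm_test_function_le \<phi>) auto
    finally show ?thesis .
  qed
  show i: "integrable lborel (\<lambda>x. f x * \<phi> x)"
  proof (rule Bochner_Integration.integrable_bound[OF int])
    show "(\<lambda>x. f x * \<phi> x) \<in> borel_measurable lborel"
      unfolding eq using meas \<phi>m by (rule borel_measurable_times)
    show "AE x in lborel. norm (f x * \<phi> x) \<le> norm ((indicator K x *\<^sub>R norm (f x)) * ?S)"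
      by (intro AE_I2 order_trans[OF bd]) (simp only: real_norm_def abs_ge_self)
  qed
  have "norm (LINT x|lborel. f x * \<phi> x) \<le> (LINT x|lborel. (indicator K x *\<^sub>R norm (f x)) * ?S)"
    using integral_norm_bound[of lborel "\<lambda>x. f x * \<phi> x"]
      integral_mono[OF integrable_norm[OF i] int bd] by linarith
  then show "norm (LINT x|lborel. f x * \<phi> x) \<le> (LINT x:K|lborel. norm (f x)) * ?S"
    by (simp add: set_lebesgue_integral_def)
qed

text \<open>Functions that are not locally integrable are sent to the zero distribution.\<close>

lift_definition regular_distr :: "(real \<Rightarrow> complex) \<Rightarrow> distribution"
  is "\<lambda>f \<phi>. if (\<forall>K. compact K \<longrightarrow> set_integrable lborel K f) \<and> \<phi> \<in> test_functions
             then (LINT x|lborel. f x * \<phi> x) else 0"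
proof (intro CollectI conjI allI impI ballI, goal_cases)
  case (2 f \<phi> \<psi> c)
  have i: "integrable lborel (\<lambda>x. f x * \<phi> x)"
    if "\<And>K. compact K \<Longrightarrow> set_integrable lborel K f" "\<phi> \<in> test_functions" for \<phi>
    using integrable_mult_test_function(1)[OF that, of "closure {x. \<phi> x \<noteq> 0}"] that(2)
    by (simp add: test_functions_def closure_subset)
  show ?case
  proof (cases "\<forall>K. compact K \<longrightarrow> set_integrable lborel K f")
    case True
    then have f: "\<And>K. compact K \<Longrightarrow> set_integrable lborel K f" by blast
    have "(LINT x|lborel. f x * (\<phi> x + c * \<psi> x))
        = (LINT x|lborel. f x * \<phi> x + c * (f x * \<psi> x))"
      by (simp add: algebra_simps)
    also have "\<dots> = (LINT x|lborel. f x * \<phi> x) + (LINT x|lborel. c * (f x * \<psi> x))"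
      by (intro Bochner_Integration.integral_add i[OF f 2(1)] integrable_mult_right i[OF f 2(2)])
    finally show ?thesis
      using True 2 by (simp add: test_functions_lincomb)
  qed auto
next
  case (3 f K)
  show ?case
  proof (cases "\<forall>K. compact K \<longrightarrow> set_integrable lborel K f")
    case True
    then show ?thesis
      using integrable_mult_test_function(2)[of f _ K] 3
      by (intro exI[of _ "LINT x:K|lborel. norm (f x)"] exI[of _ 0]) auto
  qed (auto intro!: exI[of _ 0])
qed auto

lemma distr_apply_dirac: "\<phi> \<in> test_functions \<Longrightarrow> distr_apply (dirac a) \<phi> = \<phi> a"
  by (simp add: dirac.rep_eq)

lemma distr_apply_regular_distr:
  assumes "continuous_on UNIV f" "\<phi> \<in> test_functions"
  shows "distr_apply (regular_distr f) \<phi> = (LINT x|lborel. f x * \<phi> x)"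
proof -
  have "set_integrable lborel K f" if "compact K" for K
    unfolding set_integrable_def using that assms(1)
    by (intro borel_integrable_compact) (auto intro: continuous_on_subset)
  then show ?thesis
    using assms(2) by (simp add: regular_distr.rep_eq)
qed

section \<open>The Talbot series and Gauss sums\<close>

text \<open>
  The restriction of the space-time distribution to the line at time \<open>\<tau>\<close>, as a
  distribution in \<open>x\<close>, is by definition the sum over \<open>k\<close> of the terms below.
\<close>

definition talbot_term :: "real \<Rightarrow> real \<Rightarrow> int \<Rightarrow> distribution" where
  "talbot_term M \<tau> k =
     exp (- \<i> * complex_of_real ((M * of_int k)\<^sup>2 * \<tau>)) *\<^sub>C
       regular_distr (\<lambda>x. exp (\<i> * complex_of_real (M * of_int k * x)))"

definition talbot_restriction :: "real \<Rightarrow> real \<Rightarrow> distribution" where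
  "talbot_restriction M \<tau> = (\<Sum>\<^sub>\<infinity>k\<in>UNIV. talbot_term M \<tau> k)"

definition gauss_sum :: "int \<Rightarrow> int \<Rightarrow> nat \<Rightarrow> complex" where
  "gauss_sum a b q =
     (\<Sum>l<q. exp (2 * \<i> * of_real pi * of_int (a * (int l)\<^sup>2 + b * int l) / of_nat q))"

end

theory Submission
  imports Defs
begin

text \<open>
  Poisson's formula \<open>\<Sum>k. fourier f (2 * pi * k / h) = h * (\<Sum>n. f (h * n))\<close> holds for test functions.
  At the time \<open>t\<close> the phase of the \<open>k\<close>-th term depends only on \<open>k mod q\<close>, so the series splits into
  \<open>q\<close> residue classes. To each class one applies Poisson's formula with \<open>h = 2 * pi / (M * q)\<close> and
  \<open>f x = cis (M * l * x) * \<phi> x\<close>, and the points \<open>h * n\<close> are split according to \<open>n mod q\<close>.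
  The sum over \<open>l\<close> of the phases is then the Gauss sum.
\<close>

section \<open>The Riemann--Lebesgue lemma\<close>

text \<open>The sign in \<open>fourier\<close> is that of the waves in the series, so pairing the
  \<open>k\<close>-th wave with a test function gives exactly
  \<open>fourier \<phi> (M * of_int k)\<close>. Sums of distributions here are unconditional and
  weak-*, which reduces everything to \<open>has_sum\<close> of numbers for one fixed \<phi>. The
  obstacle is that the telescoping proof of Poisson's formula controls only symmetric partial sums.
  Two integrations by parts give the transform of a test function quadratic decay, hence absolute
  convergence over the lattice, and the two limits must then agree. Poisson's formula is stated for
  differentiable functions of bounded support with a summable transform, so that it applies directly
  to the modulated \<phi>, whose transform is that of \<phi> with the frequency shifted.\<close>

definition fourier :: "(real \<Rightarrow> complex) \<Rightarrow> real \<Rightarrow> complex" where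
  "fourier f \<xi> = (LINT x|lborel. cis (\<xi> * x) * f x)"

lemma integrable_bounded_support:
  fixes f :: "real \<Rightarrow> 'a::{banach, second_countable_topology}"
  assumes "continuous_on UNIV f" "\<And>x. R < \<bar>x\<bar> \<Longrightarrow> f x = 0"
  shows "integrable lborel f"
proof -
  have "integrable lborel (\<lambda>x. indicator {-R..R} x *\<^sub>R f x)"
    using assms(1) by (intro borel_integrable_compact) (auto intro: continuous_on_subset)
  moreover have "(\<lambda>x. indicator {-R..R} x *\<^sub>R f x) = f"
    using assms(2) by (auto simp: fun_eq_iff indicator_def abs_le_iff)
  ultimately show ?thesis by simp
qed

lemma integrable_fourier:
  assumes "continuous_on UNIV f" "\<And>x. R < \<bar>x\<bar> \<Longrightarrow> f x = 0"
  shows "integrable lborel (\<lambda>x. cis (\<xi> * x) * f x)"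
  by (rule integrable_bounded_support[where R = R]) (use assms in \<open>auto intro!: continuous_intros\<close>)

lemma norm_fourier_le: "norm (fourier f \<xi>) \<le> (LINT x|lborel. norm (f x))"
  unfolding fourier_def
  by (rule order_trans[OF integral_norm_bound]) (simp add: norm_mult)

text \<open>Continuity of translation in the L1 norm, by dominated convergence: shifts of length at
  most 1 keep both functions supported within radius \<open>R + 1\<close>, where twice a bound of
  \<open>g\<close> dominates.\<close>

lemma integral_norm_translate_diff_tendsto_0:
  fixes g :: "real \<Rightarrow> complex"
  assumes g: "continuous_on UNIV g" "\<And>x. R < \<bar>x\<bar> \<Longrightarrow> g x = 0"
    and c: "c \<longlonglongrightarrow> 0" "\<And>n. \<bar>c n\<bar> \<le> 1"
  shows "(\<lambda>n. LINT x|lborel. norm (g x - g (x + c n))) \<longlonglongrightarrow> 0"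
proof -
  have "bounded (g ` {-R..R})"
    using g(1) by (intro compact_imp_bounded compact_continuous_image)
      (auto intro: continuous_on_subset)
  then obtain B where B: "\<And>x. x \<in> {-R..R} \<Longrightarrow> norm (g x) \<le> B"
    by (meson bounded_iff imageI)
  have B': "norm (g x) \<le> \<bar>B\<bar>" for x
    by (cases "x \<in> {-R..R}") (use B[of x] g(2)[of x] in auto)
  have gm: "g \<in> borel_measurable borel"
    using g(1) by (rule borel_measurable_continuous_onI)
  have "(\<lambda>n. LINT x|lborel. norm (g x - g (x + c n))) \<longlonglongrightarrow> (LINT x::real|lborel. (0 :: real))"
  proof (rule integral_dominated_convergence[where M = lborel and f = "\<lambda>_. 0"
        and s = "\<lambda>n x. norm (g x - g (x + c n))"
        and w = "\<lambda>x::real. indicator {-R-1..R+1} x *\<^sub>R (2 * \<bar>B\<bar>)"])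
    show "integrable lborel (\<lambda>x::real. indicator {-R-1..R+1} x *\<^sub>R (2 * \<bar>B\<bar>))"
      by (intro borel_integrable_compact) auto
    have "(\<lambda>n. norm (g x - g (x + c n))) \<longlonglongrightarrow> norm (g x - g (x + 0))" for x
    proof (intro tendsto_intros)
      have "isCont g (x + 0)"
        using g(1) by (simp add: continuous_on_eq_continuous_at)
      then show "(\<lambda>n. g (x + c n)) \<longlonglongrightarrow> g (x + 0)"
        by (rule isCont_tendsto_compose) (intro tendsto_intros c)
    qed
    then show "AE x in lborel. (\<lambda>n. norm (g x - g (x + c n))) \<longlonglongrightarrow> 0"
      by simp
    have "norm (g x - g (x + c n)) \<le> indicator {-R-1..R+1} x *\<^sub>R (2 * \<bar>B\<bar>)" for x n
    proof (cases "x \<in> {-R-1..R+1}")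
      case True
      then show ?thesis
        using norm_triangle_ineq4[of "g x" "g (x + c n)"] B'[of x] B'[of "x + c n"] by auto
    next
      case False
      then have "g x = 0" "g (x + c n) = 0"
        using c(2)[of n] by (auto intro!: g(2))
      with False show ?thesis by simp
    qed
    then show "AE x in lborel. norm (norm (g x - g (x + c n)))
        \<le> indicator {-R-1..R+1} x *\<^sub>R (2 * \<bar>B\<bar>)" for n
      by simp
  qed (use gm in measurable)
  then show ?thesis by simp
qed

text \<open>Translating the integrand by half a period \<open>pi / \<xi>\<close> changes the sign of the exponential.\<close>

lemma riemann_lebesgue:
  assumes g: "continuous_on UNIV g" "\<And>x. R < \<bar>x\<bar> \<Longrightarrow> g x = 0"
    and \<xi>: "filterlim \<xi> at_infinity sequentially"
  shows "(\<lambda>n. fourier g (\<xi> n)) \<longlonglongrightarrow> 0"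
proof -
  \<comment> \<open>The cut at 4 > pi keeps \<open>\<bar>c n\<bar> \<le> 1\<close> for every
    \<open>n\<close>, which the domination above requires. It changes only finitely many terms,
    because \<open>\<xi>\<close> tends to infinity.\<close>
  define c where "c n = (if \<bar>\<xi> n\<bar> < 4 then 0 else pi / \<xi> n)" for n
  have ev: "\<forall>\<^sub>F n in sequentially. 4 \<le> \<bar>\<xi> n\<bar>"
    using \<xi> unfolding filterlim_at_infinity[OF order_refl] by force
  have "(\<lambda>n. pi / \<xi> n) \<longlonglongrightarrow> 0"
    by (rule tendsto_divide_0[OF tendsto_const \<xi>])
  then have c0: "c \<longlonglongrightarrow> 0"
    by (rule Lim_transform_eventually) (use ev in eventually_elim, auto simp: c_def)
  have c1: "\<bar>c n\<bar> \<le> 1" for n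
    using pi_less_4 pi_gt_zero by (auto simp: c_def field_simps abs_divide)
  have le: "norm (2 * fourier g (\<xi> n)) \<le> (LINT x|lborel. norm (g x - g (x + c n)))"
    if "4 \<le> \<bar>\<xi> n\<bar>" for n
  proof -
    have c: "\<xi> n * c n = pi" using that by (auto simp: c_def)
    have gc: "continuous_on UNIV (\<lambda>x. g (x + c n))"
      by (rule continuous_on_compose2[OF g(1)]) (auto intro!: continuous_intros)
    have supp: "g (x + c n) = 0" if "R + 1 < \<bar>x\<bar>" for x
      using that c1[of n] by (intro g(2)) auto
    have "fourier g (\<xi> n) = (LINT x|lborel. cis (\<xi> n * (c n + x)) * g (c n + x))"
      unfolding fourier_def by (subst lborel_integral_real_affine[where c = 1 and t = "c n"]) auto
    also have "\<dots> = (LINT x|lborel. - (cis (\<xi> n * x) * g (x + c n)))"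
      by (intro Bochner_Integration.integral_cong refl)
        (simp add: distrib_left c add.commute flip: cis_mult)
    finally have "fourier g (\<xi> n) = - fourier (\<lambda>x. g (x + c n)) (\<xi> n)"
      by (simp add: fourier_def)
    then have "2 * fourier g (\<xi> n) = fourier g (\<xi> n) - fourier (\<lambda>x. g (x + c n)) (\<xi> n)"
      by simp
    also have "\<dots> = fourier (\<lambda>x. g x - g (x + c n)) (\<xi> n)"
      unfolding fourier_def right_diff_distrib
      by (intro Bochner_Integration.integral_diff[symmetric] integrable_fourier[OF g]
          integrable_fourier[OF gc supp])
    finally show ?thesis
      using norm_fourier_le by simp
  qed
  have "(\<lambda>n. 2 * fourier g (\<xi> n)) \<longlonglongrightarrow> 0"
    by (rule Lim_null_comparison[OF _ integral_norm_translate_diff_tendsto_0[OF g c0 c1]])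
      (use ev in eventually_elim, rule le)
  then show ?thesis
    using tendsto_mult_right_zero[of "\<lambda>n. 2 * fourier g (\<xi> n)" sequentially "1/2"] by simp
qed

section \<open>Poisson summation\<close>

lemma cis_2pi_eq_1_iff: "cis (2 * pi * x) = 1 \<longleftrightarrow> x \<in> \<int>"
proof
  assume "cis (2 * pi * x) = 1"
  then have "cos (2 * pi * x) = 1" by (simp add: complex_eq_iff)
  then obtain n :: int where "2 * pi * x = n * 2 * pi"
    unfolding cos_one_2pi_int by auto
  then have "x = of_int n" by (simp add: field_simps)
  then show "x \<in> \<int>" by simp
qed (rule cis_multiple_2pi)

text \<open>The zeros of \<open>cis (2 * pi * x) - 1\<close> are the integers, and they are simple,
  with derivative 2 pi i. At an integer the quotient therefore extends continuously by the
  derivative of \<open>f\<close> over 2 pi i. Continuity of \<open>g\<close> is all that the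
  Riemann--Lebesgue lemma asks for.\<close>

lemma divide_by_cis_2pi_minus_1:
  assumes f: "continuous_on UNIV f" "\<And>x. R < \<bar>x\<bar> \<Longrightarrow> f x = 0"
    and d: "\<And>n. n \<in> \<int> \<Longrightarrow> f differentiable (at n)" and z: "\<And>n. n \<in> \<int> \<Longrightarrow> f n = 0"
  obtains g where "continuous_on UNIV g" "\<And>x. R < \<bar>x\<bar> \<Longrightarrow> g x = 0"
    "\<And>x. f x = (cis (2 * pi * x) - 1) * g x"
proof
  define D where "D n = vector_derivative f (at n)" for n
  define g where "g x = (if x \<in> \<int> then D x / (2 * pi * \<i>) else f x / (cis (2 * pi * x) - 1))" for x
  show "f x = (cis (2 * pi * x) - 1) * g x" for x
    using cis_2pi_eq_1_iff[of x] by (auto simp: g_def z)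
  \<comment> \<open>At an integer \<open>n\<close> both \<open>f n\<close> and
    \<open>cis (2 * pi * n) - 1\<close> vanish, so the quotient defining \<open>g\<close> is a ratio
    of two difference quotients, and each of them converges.\<close>
  have quot: "((\<lambda>x. (h x - h n) / complex_of_real (x - n)) \<longlongrightarrow> h') (at n)"
    if "(h has_vector_derivative h') (at n)" for h h' n
  proof -
    have "((\<lambda>x. norm (h x - h n - (x - n) *\<^sub>R h') / norm (x - n)) \<longlongrightarrow> 0) (at n)"
      using that unfolding has_vector_derivative_def has_derivative_iff_norm by blast
    moreover have "\<forall>\<^sub>F x in at n. norm (h x - h n - (x - n) *\<^sub>R h') / norm (x - n)
        = norm ((h x - h n) / complex_of_real (x - n) - h')"
      unfolding eventually_at_filter
    proof (intro always_eventually allI impI)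
      fix x assume "x \<noteq> n"
      then have "(h x - h n) / complex_of_real (x - n) - h'
          = (h x - h n - (x - n) *\<^sub>R h') / complex_of_real (x - n)"
        by (simp add: diff_divide_distrib scaleR_conv_of_real del: of_real_diff)
      then show "norm (h x - h n - (x - n) *\<^sub>R h') / norm (x - n)
          = norm ((h x - h n) / complex_of_real (x - n) - h')"
        by (simp add: norm_divide del: of_real_diff)
    qed
    ultimately have "((\<lambda>x. norm ((h x - h n) / complex_of_real (x - n) - h')) \<longlongrightarrow> 0) (at n)"
      by (rule Lim_transform_eventually)
    then show ?thesis
      by (rule LIM_zero_cancel[OF tendsto_norm_zero_cancel])
  qed
  have "isCont g n" for n
  proof (cases "n \<in> \<int>")
    case True
    have "(f has_vector_derivative D n) (at n)"
      using d[OF True] by (simp add: D_def vector_derivative_works)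
    moreover have "((\<lambda>x. cis (2 * pi * x)) has_vector_derivative (2 * pi * \<i>)) (at n)"
      using True unfolding has_vector_derivative_def
      by (auto intro!: derivative_eq_intros simp: fun_eq_iff scaleR_conv_of_real)
    ultimately have "((\<lambda>x. ((f x - f n) / complex_of_real (x - n))
        / ((cis (2 * pi * x) - cis (2 * pi * n)) / complex_of_real (x - n)))
        \<longlongrightarrow> D n / (2 * pi * \<i>)) (at n)"
      by (intro tendsto_divide quot) auto
    \<comment> \<open>The ball of radius 1 about an integer contains no other integer, so near
      \<open>n\<close> only the second branch of \<open>g\<close> is in play.\<close>
    moreover have "\<forall>\<^sub>F x in at n. x \<notin> \<int>"
    proof -
      have "\<forall>\<^sub>F x in at n. x \<in> ball n 1 - {n}"
        by (rule eventually_at_in_open) auto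
      then show ?thesis
        by eventually_elim (use True in \<open>auto elim!: Ints_cases simp: dist_real_def\<close>)
    qed
    then have "\<forall>\<^sub>F x in at n. ((f x - f n) / complex_of_real (x - n))
        / ((cis (2 * pi * x) - cis (2 * pi * n)) / complex_of_real (x - n)) = g x"
      by eventually_elim (use True in \<open>auto simp: g_def z\<close>)
    ultimately have "(g \<longlongrightarrow> D n / (2 * pi * \<i>)) (at n)"
      by (rule Lim_transform_eventually)
    then show ?thesis
      using True by (simp add: isCont_def g_def)
  next
    case False
    have "isCont (\<lambda>x. cis (2 * pi * x)) n"
      by (rule continuous_on_interior[of UNIV]) (auto intro!: continuous_intros)
    then have "isCont (\<lambda>x. f x / (cis (2 * pi * x) - 1)) n"
      using f(1) False
      by (intro continuous_intros) (auto simp: cis_2pi_eq_1_iff continuous_on_eq_continuous_at)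
    moreover have "\<forall>\<^sub>F x in nhds n. x \<in> - \<int>"
      using False by (intro eventually_nhds_in_open) (auto intro: closed_Ints)
    then have "\<forall>\<^sub>F x in nhds n. f x / (cis (2 * pi * x) - 1) = g x"
      by eventually_elim (auto simp: g_def)
    ultimately show ?thesis
      by (simp add: isCont_cong)
  qed
  then show "continuous_on UNIV g"
    by (simp add: continuous_on_eq_continuous_at)
  show "g x = 0" if "R < \<bar>x\<bar>" for x
  proof -
    \<comment> \<open>At integers outside the support the value of \<open>g\<close> comes from a
      derivative, which is 0 because \<open>f\<close> vanishes on a whole neighbourhood.\<close>
    have "(f has_vector_derivative 0) (at x)"
    proof (rule has_vector_derivative_transform_within_open[of "\<lambda>_. 0"])
      show "open {x. R < \<bar>x\<bar>}"
        by (intro open_Collect_less continuous_intros)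
    qed (use that f(2) in auto)
    then show ?thesis
      using f(2)[OF that] by (simp add: g_def D_def vector_derivative_at)
  qed
qed

text \<open>The raised cosine, equal to the square of cos (pi x / 2) on its support. It separates
  the integers and meets 0 with slope 0 at both ends. The tent function has the same values at the
  integers, but its corners lie there, exactly where the division lemma needs a derivative.\<close>

definition hat :: "real \<Rightarrow> complex" where
  "hat x = (if x \<in> {-1..1} then (1 + complex_of_real (cos (pi * x))) / 2 else 0)"

lemma hat_eq_0: "1 < \<bar>x\<bar> \<Longrightarrow> hat x = 0"
  by (auto simp: hat_def)

lemma hat_of_int: "hat (of_int j) = of_bool (j = 0)"
proof (cases "\<bar>j\<bar> \<le> 1")
  case True
  then have "j = -1 \<or> j = 0 \<or> j = 1" by arith
  then show ?thesis by (auto simp: hat_def)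
next
  case False
  then have "1 < \<bar>real_of_int j\<bar>" by linarith
  with False show ?thesis using hat_eq_0 by auto
qed

lemma differentiable_hat: "hat differentiable (at x)"
proof -
  \<comment> \<open>Two closed sets covering the line and meeting only at 1 and -1, where the values
    and the derivatives of both branches are 0.\<close>
  let ?S = "{-1..1::real}" and ?T = "{..-1} \<union> {1::real..}"
  have cl: "closure ?T = ?T" by (intro closure_closed closed_Un) auto
  have "((\<lambda>x. if x \<in> ?S then (1 + complex_of_real (cos (pi * x))) / 2 else 0) has_vector_derivative
      (if x \<in> ?S then - complex_of_real (pi * sin (pi * x)) / 2 else 0)) (at x within UNIV)"
  proof (rule has_vector_derivative_If_within_closures[where T = ?T])
    show "((\<lambda>x. (1 + complex_of_real (cos (pi * x))) / 2) has_vector_derivative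
        - complex_of_real (pi * sin (pi * x)) / 2) (at x within A)" for A
      unfolding has_vector_derivative_def
      by (auto intro!: derivative_eq_intros simp: fun_eq_iff scaleR_conv_of_real field_simps)
    show "(1 + complex_of_real (cos (pi * x))) / 2 = 0"
      "- complex_of_real (pi * sin (pi * x)) / 2 = 0" if "x \<in> closure ?S" "x \<in> closure ?T"
    proof -
      have "x = 1 \<or> x = -1" using that unfolding cl by auto
      then show "(1 + complex_of_real (cos (pi * x))) / 2 = 0"
        "- complex_of_real (pi * sin (pi * x)) / 2 = 0" by auto
    qed
  qed auto
  then show ?thesis
    unfolding hat_def[abs_def] by (rule differentiableI_vector)
qed

lemma continuous_hat: "continuous_on A hat"
  by (simp add: continuous_at_imp_continuous_on differentiable_imp_continuous_within differentiable_hat)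

text \<open>Every integrand has period 2, the length of the interval. Odd multiples of pi occur
  because the cosine in \<open>hat\<close> shifts the frequency 2 pi k by pi in either
  direction.\<close>

lemma integral_cis_two_half_periods:
  "(LINT x|lborel. indicator {-1..1} x *\<^sub>R cis (pi * of_int m * x)) = (if m = 0 then 2 else 0)"
proof (cases "m = 0")
  case True
  have "(LINT x|lborel. indicator {-1..1::real} x *\<^sub>R (1 :: complex)) = of_real 1 - of_real (-1)"
    by (rule integral_FTC_atLeastAtMost[where F = complex_of_real])
      (auto intro!: derivative_eq_intros simp: has_vector_derivative_def scaleR_conv_of_real)
  with True show ?thesis by simp
next
  case False
  let ?F = "\<lambda>x. cis (pi * of_int m * x) / (\<i> * pi * of_int m)"
  have "(LINT x|lborel. indicator {-1..1} x *\<^sub>R cis (pi * of_int m * x)) = ?F 1 - ?F (-1)"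
  proof (rule integral_FTC_atLeastAtMost)
    show "(?F has_vector_derivative cis (pi * of_int m * x)) (at x within A)" for x A
      unfolding has_vector_derivative_def using False
      by (auto intro!: derivative_eq_intros simp: fun_eq_iff scaleR_conv_of_real field_simps)
  qed (auto intro!: continuous_intros)
  moreover have "cis (pi * of_int m * 1) = cis (pi * of_int m * (-1)) * cis (2 * pi * of_int m)"
    unfolding cis_mult by simp
  ultimately show ?thesis
    using False by simp
qed

text \<open>Splitting the cosine into exponentials leaves the frequencies \<open>2 * k\<close>,
  \<open>2 * k + 1\<close> and \<open>2 * k - 1\<close> in units of pi. The odd ones are never 0, so
  only the first integral can survive, and only for \<open>k = 0\<close>.\<close>

lemma fourier_hat: "fourier hat (2 * pi * of_int k) = of_bool (k = 0)"
proof -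
  let ?I = "\<lambda>m x. indicator {-1..1} x *\<^sub>R cis (pi * of_int m * x)"
  have int: "integrable lborel (?I m)" for m
    by (intro borel_integrable_compact) (auto intro!: continuous_intros)
  have "cis (2 * pi * of_int k * x) * hat x
      = ?I (2 * k) x / 2 + ?I (2 * k + 1) x / 4 + ?I (2 * k - 1) x / 4" for x
  proof -
    have e: "cis (pi * of_int (2 * k) * x) = cis (2 * pi * of_int k * x)"
      "cis (pi * of_int (2 * k + 1) * x) = cis (2 * pi * of_int k * x) * cis (pi * x)"
      "cis (pi * of_int (2 * k - 1) * x) = cis (2 * pi * of_int k * x) * cis (- (pi * x))"
      unfolding cis_mult by (simp_all add: algebra_simps)
    have c: "complex_of_real (cos (pi * x)) = (cis (pi * x) + cis (- (pi * x))) / 2"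
      by (simp add: complex_eq_iff)
    show ?thesis
      unfolding e c hat_def indicator_def by (simp add: add_divide_distrib algebra_simps)
  qed
  then have "fourier hat (2 * pi * of_int k)
      = (LINT x|lborel. ?I (2 * k) x / 2 + ?I (2 * k + 1) x / 4 + ?I (2 * k - 1) x / 4)"
    unfolding fourier_def by simp
  also have "\<dots> = (LINT x|lborel. ?I (2 * k) x) / 2 + (LINT x|lborel. ?I (2 * k + 1) x) / 4
      + (LINT x|lborel. ?I (2 * k - 1) x) / 4"
    by (subst Bochner_Integration.integral_add,
        intro Bochner_Integration.integrable_add integrable_divide int,
        intro integrable_divide int,
        subst Bochner_Integration.integral_add,
        (intro integrable_divide int)+, simp)
  also have "\<dots> = of_bool (k = 0)"
  proof -
    have "2 * k + 1 \<noteq> 0" "2 * k - 1 \<noteq> 0" by presburger+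
    then show ?thesis unfolding integral_cis_two_half_periods by simp
  qed
  finally show ?thesis .
qed

section \<open>Transformation rules and Poisson's formula for symmetric partial sums\<close>

lemma fourier_translate: "fourier (\<lambda>x. f (x - a)) \<xi> = cis (\<xi> * a) * fourier f \<xi>"
proof -
  have "fourier (\<lambda>x. f (x - a)) \<xi> = (LINT x|lborel. cis (\<xi> * (a + x)) * f x)"
    unfolding fourier_def by (subst lborel_integral_real_affine[where c = 1 and t = a]) auto
  also have "\<dots> = (LINT x|lborel. cis (\<xi> * a) * (cis (\<xi> * x) * f x))"
    by (simp add: distrib_left mult.assoc flip: cis_mult)
  finally show ?thesis
    unfolding fourier_def by simp
qed

lemma fourier_dilate: "c > 0 \<Longrightarrow> fourier f \<xi> = c * fourier (\<lambda>x. f (c * x)) (c * \<xi>)"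
  unfolding fourier_def
  by (subst lborel_integral_real_affine[where c = c and t = 0])
    (auto simp: scaleR_conv_of_real mult_ac)

lemma sum_telescope_symmetric:
  fixes u :: "int \<Rightarrow> 'a::ab_group_add"
  shows "(\<Sum>k\<in>{- int N..int N}. u (k + 1) - u k) = u (int N + 1) - u (- int N)"
proof (induction N)
  case (Suc N)
  have "{- int (Suc N)..int (Suc N)} = insert (- 1 - int N) (insert (int N + 1) {- int N..int N})"
    by auto
  then show ?case
    by (simp add: Suc.IH algebra_simps)
qed simp

text \<open>Subtracting translates of \<^const>\<open>hat\<close>, for which the formula is trivial, reduces to the case
  where \<open>f\<close> vanishes on the integers. Then \<open>f x = (cis (2 * pi * x) - 1) * g x\<close>, so that the sum
  telescopes and the remaining boundary terms vanish by the Riemann--Lebesgue lemma.\<close>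

lemma poisson_symmetric_int:
  assumes f: "continuous_on UNIV f" "\<And>x. R < \<bar>x\<bar> \<Longrightarrow> f x = 0"
    and d: "\<And>n. n \<in> \<int> \<Longrightarrow> f differentiable (at n)" and m: "R \<le> of_int m"
  shows "(\<lambda>N. \<Sum>k\<in>{- int N..int N}. fourier f (2 * pi * of_int k))
    \<longlonglongrightarrow> (\<Sum>n\<in>{-m..m}. f (of_int n))"
proof -
  define f0 where "f0 x = f x - (\<Sum>n\<in>{-m..m}. f (of_int n) * hat (x - of_int n))" for x
  have hat_c: "continuous_on UNIV (\<lambda>x. hat (x - a))" for a
    by (rule continuous_on_compose2[OF continuous_hat]) (auto intro!: continuous_intros)
  have hat_s: "hat (x - of_int n) = 0" if "n \<in> {-m..m}" "of_int m + 1 < \<bar>x\<bar>" for x n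
  proof (rule hat_eq_0)
    have "\<bar>real_of_int n\<bar> \<le> of_int m" using that(1) by auto
    then show "1 < \<bar>x - of_int n\<bar>" using that(2) by linarith
  qed
  have f0_c: "continuous_on UNIV f0"
    unfolding f0_def[abs_def] by (intro continuous_intros f hat_c)
  \<comment> \<open>The translates of \<open>hat\<close> reach one unit beyond the outermost nodes
    \<open>m\<close> and \<open>-m\<close>.\<close>
  have f0_s: "f0 x = 0" if "of_int m + 1 < \<bar>x\<bar>" for x
    using that m by (auto simp: f0_def f(2) hat_s intro!: sum.neutral)
  have f0_d: "f0 differentiable (at n)" if "n \<in> \<int>" for n
  proof -
    have "(\<lambda>x. hat (x - a)) differentiable (at n)" for a
      by (rule differentiable_compose[of hat "\<lambda>x. x - a"])
         (auto intro!: differentiable_hat derivative_intros)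
    then show ?thesis
      unfolding f0_def[abs_def]
      by (intro differentiable_diff d that differentiable_sum differentiable_mult) auto
  qed
  have f0_z: "f0 x = 0" if x_int: "x \<in> \<int>" for x
  proof -
    obtain j where x: "x = of_int j" using x_int by (rule Ints_cases)
    have "(\<Sum>n\<in>{-m..m}. f (of_int n) * hat (x - of_int n))
        = (\<Sum>n\<in>{-m..m}. if j = n then f (of_int n) else 0)"
      by (intro sum.cong refl) (simp add: x hat_of_int flip: of_int_diff)
    also have "\<dots> = f x"
    proof (cases "j \<in> {-m..m}")
      case False
      then have "of_int m < \<bar>x\<bar>" unfolding x by auto
      then have "f x = 0" using m by (intro f(2)) simp
      then show ?thesis by (simp add: x)
    qed (simp add: x)
    finally show ?thesis by (simp add: f0_def)
  qed
  obtain g where g: "continuous_on UNIV g" "\<And>x. of_int m + 1 < \<bar>x\<bar> \<Longrightarrow> g x = 0"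
    "\<And>x. f0 x = (cis (2 * pi * x) - 1) * g x"
    using divide_by_cis_2pi_minus_1[OF f0_c f0_s f0_d f0_z] by blast
  \<comment> \<open>Multiplying by \<open>cis (2 * pi * x)\<close> raises the frequency index from
    \<open>k\<close> to \<open>k + 1\<close>.\<close>
  have F0: "fourier f0 (2 * pi * of_int k)
      = fourier g (2 * pi * of_int (k + 1)) - fourier g (2 * pi * of_int k)" for k
  proof -
    have "fourier f0 (2 * pi * of_int k)
        = (LINT x|lborel. cis (2 * pi * of_int (k + 1) * x) * g x - cis (2 * pi * of_int k * x) * g x)"
      unfolding fourier_def
      by (intro Bochner_Integration.integral_cong refl)
        (simp add: g(3) algebra_simps cis_mult)
    then show ?thesis
      unfolding fourier_def
      by (subst (asm) Bochner_Integration.integral_diff) (auto intro!: integrable_fourier[OF g(1,2)])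
  qed
  have F_f0: "fourier f0 \<xi> = fourier f \<xi>
      - (\<Sum>n\<in>{-m..m}. f (of_int n) * fourier (\<lambda>x. hat (x - of_int n)) \<xi>)"
    for \<xi>
  proof -
    have i: "integrable lborel (\<lambda>x. f (of_int n) * (cis (\<xi> * x) * hat (x - of_int n)))"
      if "n \<in> {-m..m}" for n
      by (intro integrable_mult_right integrable_fourier[OF hat_c hat_s[OF that]])
    have "fourier f0 \<xi> = (LINT x|lborel. cis (\<xi> * x) * f x
        - (\<Sum>n\<in>{-m..m}. f (of_int n) * (cis (\<xi> * x) * hat (x - of_int n))))"
      unfolding fourier_def f0_def
      by (simp add: right_diff_distrib sum_distrib_left mult_ac)
    also have "\<dots> = fourier f \<xi> - (LINT x|lborel.
        (\<Sum>n\<in>{-m..m}. f (of_int n) * (cis (\<xi> * x) * hat (x - of_int n))))"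
      unfolding fourier_def
      by (intro Bochner_Integration.integral_diff integrable_fourier[OF f]
          Bochner_Integration.integrable_sum i)
    also have "(LINT x|lborel. (\<Sum>n\<in>{-m..m}. f (of_int n) * (cis (\<xi> * x) * hat (x - of_int n))))
        = (\<Sum>n\<in>{-m..m}. LINT x|lborel. f (of_int n) * (cis (\<xi> * x) * hat (x - of_int n)))"
      by (rule Bochner_Integration.integral_sum[OF i])
    also have "\<dots> = (\<Sum>n\<in>{-m..m}. f (of_int n) * fourier (\<lambda>x. hat (x - of_int n)) \<xi>)"
      by (simp add: fourier_def)
    finally show ?thesis .
  qed
  have F_hat: "fourier (\<lambda>x. hat (x - of_int n)) (2 * pi * of_int k) = of_bool (k = 0)" for k n
  proof -
    have "cis (2 * pi * of_int k * of_int n) = 1"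
      using cis_multiple_2pi[of "of_int (k * n)"] by (simp add: mult.assoc)
    then show ?thesis
      by (simp only: fourier_translate fourier_hat mult_1_left)
  qed
  \<comment> \<open>All node values enter through the term \<open>k = 0\<close>, so each symmetric
    partial sum contains the whole right-hand side plus a telescoping remainder.\<close>
  have F: "fourier f (2 * pi * of_int k)
      = (fourier g (2 * pi * of_int (k + 1)) - fourier g (2 * pi * of_int k))
        + of_bool (k = 0) * (\<Sum>n\<in>{-m..m}. f (of_int n))" for k
  proof -
    have "fourier f (2 * pi * of_int k) = fourier f0 (2 * pi * of_int k)
        + (\<Sum>n\<in>{-m..m}. f (of_int n) * fourier (\<lambda>x. hat (x - of_int n)) (2 * pi * of_int k))"
      unfolding F_f0 by simp
    also have "(\<Sum>n\<in>{-m..m}. f (of_int n) * fourier (\<lambda>x. hat (x - of_int n)) (2 * pi * of_int k))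
        = of_bool (k = 0) * (\<Sum>n\<in>{-m..m}. f (of_int n))"
      unfolding F_hat sum_distrib_left by (simp only: mult.commute)
    finally show ?thesis unfolding F0 .
  qed
  have "(\<Sum>k\<in>{- int N..int N}. fourier f (2 * pi * of_int k))
      = fourier g (2 * pi * of_int (int N + 1)) - fourier g (2 * pi * of_int (- int N))
        + (\<Sum>n\<in>{-m..m}. f (of_int n))" for N
    unfolding F sum.distrib
      sum_telescope_symmetric[where u = "\<lambda>k. fourier g (2 * pi * of_int k)"]
    by (simp flip: sum_distrib_right)
  moreover have "(\<lambda>N. fourier g (2 * pi * of_int (int N + 1)) - fourier g (2 * pi * of_int (- int N))
        + (\<Sum>n\<in>{-m..m}. f (of_int n))) \<longlonglongrightarrow> 0 - 0 + (\<Sum>n\<in>{-m..m}. f (of_int n))"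
  proof (intro tendsto_intros riemann_lebesgue[OF g(1,2)])
    have 1: "filterlim (\<lambda>N. 2 * pi * real N) at_top sequentially"
      by (intro filterlim_tendsto_pos_mult_at_top[OF tendsto_const] filterlim_real_sequentially) auto
    show "filterlim (\<lambda>N. 2 * pi * of_int (- int N)) at_infinity sequentially"
      by (rule filterlim_norm_at_top_imp_at_infinity) (use 1 in \<open>simp add: abs_mult\<close>)
    have "filterlim (\<lambda>N. 2 * pi * real (Suc N)) at_infinity sequentially"
      by (rule filterlim_compose[OF filterlim_at_top_imp_at_infinity[OF 1] filterlim_Suc])
    then show "filterlim (\<lambda>N. 2 * pi * of_int (int N + 1)) at_infinity sequentially"
      by (simp add: add.commute)
  qed
  ultimately show ?thesis by simp
qed

text \<open>The substitution \<open>x = h * y\<close> carries the lattice of step \<open>h\<close>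
  to the integers and shrinks the support radius to \<open>R / h\<close>; the factor
  \<open>h\<close> is its Jacobian.\<close>

lemma poisson_symmetric:
  assumes f: "\<And>x. f differentiable (at x)" "\<And>x. R < \<bar>x\<bar> \<Longrightarrow> f x = 0"
    and h: "0 < h" and m: "R \<le> h * of_int m"
  shows "(\<lambda>N. \<Sum>k\<in>{- int N..int N}. fourier f (2 * pi / h * of_int k))
    \<longlonglongrightarrow> h * (\<Sum>n\<in>{-m..m}. f (h * of_int n))"
proof -
  have d: "(\<lambda>x. f (h * x)) differentiable (at x)" for x
    by (rule differentiable_compose[of f "\<lambda>x. h * x"]) (auto intro!: f derivative_intros)
  have "(\<lambda>N. \<Sum>k\<in>{- int N..int N}. fourier (\<lambda>x. f (h * x)) (2 * pi * of_int k))
    \<longlonglongrightarrow> (\<Sum>n\<in>{-m..m}. f (h * of_int n))"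
  proof (rule poisson_symmetric_int[where R = "R / h"])
    show "f (h * x) = 0" if "R / h < \<bar>x\<bar>" for x
      using that h by (intro f(2)) (simp add: abs_mult field_simps)
    show "R / h \<le> of_int m"
      using m h by (simp add: field_simps)
  qed (auto intro!: d continuous_at_imp_continuous_on differentiable_imp_continuous_within)
  from tendsto_mult_left[OF this, of "complex_of_real h"] show ?thesis
    using h by (simp add: sum_distrib_left fourier_dilate[OF h, of f])
qed

section \<open>Decay of the transform and unconditional summation\<close>

lemma fourier_derivative:
  assumes f: "\<And>x. (f has_vector_derivative f' x) (at x)" "\<And>x. R < \<bar>x\<bar> \<Longrightarrow> f x = 0"
    and f': "continuous_on UNIV f'" "\<And>x. R < \<bar>x\<bar> \<Longrightarrow> f' x = 0"
  shows "fourier f' \<xi> = - (\<i> * \<xi> * fourier f \<xi>)"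
proof -
  \<comment> \<open>A point strictly outside the support, also when \<open>R\<close> is negative, so
    the boundary values at \<open>S\<close> and \<open>-S\<close> vanish.\<close>
  define S where "S = \<bar>R\<bar> + 1"
  have f_c: "continuous_on UNIV f"
    using f(1) has_vector_derivative_continuous continuous_at_imp_continuous_on by blast
  let ?G = "\<lambda>x. cis (\<xi> * x) * f' x + \<i> * \<xi> * (cis (\<xi> * x) * f x)"
  have "(LINT x|lborel. indicator {-S..S} x *\<^sub>R ?G x) = cis (\<xi> * S) * f S - cis (\<xi> * (-S)) * f (-S)"
  proof (rule integral_FTC_atLeastAtMost)
    have c: "((\<lambda>x. cis (\<xi> * x)) has_vector_derivative \<i> * \<xi> * cis (\<xi> * x)) (at x)" for x
      unfolding has_vector_derivative_def
      by (auto intro!: derivative_eq_intros simp: fun_eq_iff scaleR_conv_of_real)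
    show "((\<lambda>x. cis (\<xi> * x) * f x) has_vector_derivative ?G x) (at x within {-S..S})" for x
      using has_vector_derivative_at_within[OF has_vector_derivative_mult[OF c f(1)]]
      by (simp add: mult.assoc)
  qed (auto simp: S_def intro!: continuous_intros continuous_on_subset[OF f_c] continuous_on_subset[OF f'(1)])
  also have "\<dots> = 0"
    by (simp add: f(2) S_def)
  also have "(\<lambda>x. indicator {-S..S} x *\<^sub>R ?G x) = ?G"
    using f(2) f'(2) by (auto simp: fun_eq_iff indicator_def S_def)
  finally have "(LINT x|lborel. ?G x) = 0" .
  then have "fourier f' \<xi> + \<i> * \<xi> * fourier f \<xi> = 0"
    unfolding fourier_def
    by (subst (asm) Bochner_Integration.integral_add)
      (auto intro!: integrable_mult_right integrable_fourier[OF f'] integrable_fourier[OF f_c f(2)])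
  then show ?thesis
    by (simp add: eq_neg_iff_add_eq_0)
qed

lemma test_function_bounded_support:
  assumes "\<phi> \<in> test_functions"
  obtains R where "\<And>x. R < \<bar>x\<bar> \<Longrightarrow> \<phi> x = 0"
proof -
  have "bounded (closure {x. \<phi> x \<noteq> 0})"
    using assms unfolding test_functions_def by (auto intro: compact_imp_bounded)
  then obtain R where R: "\<And>x. x \<in> closure {x. \<phi> x \<noteq> 0} \<Longrightarrow> norm x \<le> R"
    unfolding bounded_iff by blast
  have "\<phi> x = 0" if "R < \<bar>x\<bar>" for x
  proof (rule ccontr)
    assume "\<phi> x \<noteq> 0"
    then have "x \<in> closure {x. \<phi> x \<noteq> 0}"
      using closure_subset[of "{x. \<phi> x \<noteq> 0}"] by blast
    from R[OF this] that show False by simp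
  qed
  then show thesis by (rule that)
qed

lemma test_functions_has_vector_derivative:
  assumes "\<phi> \<in> test_functions"
  shows "(\<phi> has_vector_derivative nth_deriv 1 \<phi> x) (at x)"
proof -
  have "nth_deriv 0 \<phi> differentiable (at x)"
    using assms unfolding test_functions_def by blast
  then show ?thesis
    using nth_deriv_Suc[of 0 \<phi> x] by (simp add: vector_derivative_works)
qed

lemma fourier_nth_deriv_1:
  assumes "\<phi> \<in> test_functions"
  shows "fourier (nth_deriv 1 \<phi>) \<xi> = - (\<i> * \<xi> * fourier \<phi> \<xi>)"
proof -
  have \<phi>': "nth_deriv 1 \<phi> \<in> test_functions"
    by (rule nth_deriv_in_test_functions[OF assms])
  obtain R where R: "\<And>x. R < \<bar>x\<bar> \<Longrightarrow> \<phi> x = 0"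
    using test_function_bounded_support[OF assms] by blast
  obtain R' where R': "\<And>x. R' < \<bar>x\<bar> \<Longrightarrow> nth_deriv 1 \<phi> x = 0"
    using test_function_bounded_support[OF \<phi>'] by blast
  show ?thesis
    by (rule fourier_derivative[where R = "max R R'"])
      (simp_all only: test_functions_has_vector_derivative[OF assms]
        test_functions_continuous[OF \<phi>'] R R' max_less_iff_conj)
qed

text \<open>Each derivative contributes a factor of modulus \<open>\<bar>\<xi>\<bar>\<close>, and
  the L1 norm of the second derivative bounds its transform uniformly. Two derivatives are taken
  because inverse squares are summable over the lattice.\<close>

lemma fourier_decay:
  assumes "\<phi> \<in> test_functions"
  obtains C where "\<And>\<xi>. \<xi>\<^sup>2 * norm (fourier \<phi> \<xi>) \<le> C"
proof
  let ?\<phi>'' = "nth_deriv 1 (nth_deriv 1 \<phi>)"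
  show "\<xi>\<^sup>2 * norm (fourier \<phi> \<xi>) \<le> (LINT x|lborel. norm (?\<phi>'' x))" for \<xi>
  proof -
    have "norm (fourier ?\<phi>'' \<xi>) = \<bar>\<xi>\<bar> * (\<bar>\<xi>\<bar> * norm (fourier \<phi> \<xi>))"
      by (simp add: fourier_nth_deriv_1 nth_deriv_in_test_functions assms norm_mult
          del: One_nat_def)
    also have "\<dots> = \<xi>\<^sup>2 * norm (fourier \<phi> \<xi>)"
      by (simp add: power2_eq_square flip: mult.assoc)
    finally show ?thesis
      using norm_fourier_le[of ?\<phi>'' \<xi>] by simp
  qed
qed

text \<open>The integers are covered by two copies of the naturals that overlap at 0, where the term
  is 0 by the convention for division.\<close>

lemma summable_on_inverse_square_int: "(\<lambda>k::int. 1 / (of_int k)\<^sup>2 :: real) summable_on UNIV"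
proof -
  let ?f = "\<lambda>k::int. 1 / (of_int k)\<^sup>2 :: real"
  have "summable (\<lambda>n. norm (1 / (real n)\<^sup>2))"
    using inverse_power_summable[of 2, where 'a = real] by (simp add: divide_inverse norm_power)
  then have n: "(\<lambda>n. 1 / (real n)\<^sup>2) summable_on UNIV"
    by (rule norm_summable_imp_summable_on)
  have "?f summable_on (range int)" "?f summable_on (range (\<lambda>n. - int n))"
    by (subst summable_on_reindex; use n in \<open>simp add: o_def inj_def\<close>)+
  then have "?f summable_on (range int \<union> range (\<lambda>n. - int n))"
    by (rule summable_on_union)
  moreover have "range int \<union> range (\<lambda>n. - int n) = UNIV"
    using int_cases2 by blast
  ultimately show ?thesis by simp
qed

lemma abs_summable_fourier_lattice:
  assumes "\<phi> \<in> test_functions" "M \<noteq> 0"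
  shows "(\<lambda>k::int. norm (fourier \<phi> (M * of_int k))) summable_on UNIV"
proof -
  obtain C where C: "\<And>\<xi>. \<xi>\<^sup>2 * norm (fourier \<phi> \<xi>) \<le> C"
    using fourier_decay[OF assms(1)] by blast
  \<comment> \<open>At \<open>k = 0\<close> the majorant is 0 while the transform may not be, so
    this single term is added back afterwards.\<close>
  have "(\<lambda>k::int. norm (fourier \<phi> (M * of_int k))) summable_on (UNIV - {0})"
  proof (rule Infinite_Sum.abs_summable_on_comparison_test')
    show "(\<lambda>k::int. C / M\<^sup>2 * (1 / (of_int k)\<^sup>2)) summable_on (UNIV - {0})"
      by (rule summable_on_subset[OF summable_on_cmult_right[OF summable_on_inverse_square_int]]) simp
    show "norm (fourier \<phi> (M * of_int k)) \<le> C / M\<^sup>2 * (1 / (of_int k)\<^sup>2)" if "k \<in> UNIV - {0}" for k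
      using C[of "M * of_int k"] that assms(2) by (simp add: field_simps power_mult_distrib)
  qed
  then have "(\<lambda>k::int. norm (fourier \<phi> (M * of_int k))) summable_on (UNIV - {0} \<union> {0})"
    by (intro summable_on_union) auto
  then show ?thesis by simp
qed

text \<open>The symmetric intervals are eventually above any finite set of integers, so their
  partial sums follow the net that defines \<open>has_sum\<close>.\<close>

lemma has_sum_int_imp_symmetric_limit:
  assumes "(f has_sum s) (UNIV :: int set)"
  shows "(\<lambda>N. \<Sum>k\<in>{- int N..int N}. f k) \<longlonglongrightarrow> s"
proof -
  have "filterlim (\<lambda>N. {- int N..int N}) (finite_subsets_at_top UNIV) sequentially"
    unfolding filterlim_finite_subsets_at_top
  proof (intro allI impI)
    fix X :: "int set"
    assume "finite X \<and> X \<subseteq> UNIV"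
    then have fin: "finite (abs ` X)" by simp
    \<comment> \<open>The inserted 0 keeps \<open>Max\<close> meaningful when \<open>X\<close> is
      empty.\<close>
    have "X \<subseteq> {- int N..int N}" if N: "nat (Max (insert 0 (abs ` X))) \<le> N" for N
    proof
      fix x assume "x \<in> X"
      then have "\<bar>x\<bar> \<le> Max (insert 0 (abs ` X))"
        using fin by (intro Max_ge) auto
      then show "x \<in> {- int N..int N}" using N by auto
    qed
    then show "\<forall>\<^sub>F N in sequentially. finite {- int N..int N} \<and> X \<subseteq> {- int N..int N}
        \<and> {- int N..int N} \<subseteq> UNIV"
      unfolding eventually_sequentially by blast
  qed
  with assms show ?thesis
    unfolding has_sum_def by (rule filterlim_compose)
qed

lemma finite_lattice_points:
  fixes a h R :: real
  assumes "h > 0"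
  shows "finite {k::int. \<bar>a + h * of_int k\<bar> \<le> R}"
proof (rule finite_subset)
  show "{k::int. \<bar>a + h * of_int k\<bar> \<le> R} \<subseteq> {\<lfloor>(- R - a) / h\<rfloor>..\<lceil>(R - a) / h\<rceil>}"
  proof
    fix k :: int assume "k \<in> {k::int. \<bar>a + h * of_int k\<bar> \<le> R}"
    then have "(- R - a) / h \<le> of_int k" "of_int k \<le> (R - a) / h"
      using assms by (auto simp: field_simps abs_le_iff)
    then show "k \<in> {\<lfloor>(- R - a) / h\<rfloor>..\<lceil>(R - a) / h\<rceil>}"
      by (auto simp: floor_le_iff le_ceiling_iff)
  qed
qed simp

text \<open>Absolute convergence turns the symmetric summation into unconditional summation.\<close>

lemma poisson_summation:
  assumes f: "\<And>x. f differentiable (at x)" "\<And>x. R < \<bar>x\<bar> \<Longrightarrow> f x = 0"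
    and h: "0 < h" and s: "(\<lambda>k::int. fourier f (2 * pi / h * of_int k)) summable_on UNIV"
  shows "((\<lambda>k::int. fourier f (2 * pi / h * of_int k)) has_sum
    (h * (\<Sum>\<^sub>\<infinity>n\<in>(UNIV::int set). f (h * of_int n)))) UNIV"
proof -
  define m where "m = \<lceil>R / h\<rceil>"
  have m: "R \<le> h * of_int m"
    using mult_left_mono[OF le_of_int_ceiling[of "R / h"], of h] h by (simp add: m_def)
  have "((\<lambda>n. f (h * of_int n)) has_sum (\<Sum>n\<in>{-m..m}. f (h * of_int n))) UNIV"
  proof (rule has_sum_finite_neutralI)
    fix n assume "n \<in> UNIV - {-m..m}"
    then have "of_int m < \<bar>real_of_int n\<bar>" by auto
    then have "h * of_int m < \<bar>h * of_int n\<bar>" using h by (simp add: abs_mult)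
    then show "f (h * of_int n) = 0" using m by (intro f(2)) simp
  qed auto
  then have "(\<Sum>\<^sub>\<infinity>n\<in>(UNIV::int set). f (h * of_int n)) = (\<Sum>n\<in>{-m..m}. f (h * of_int n))"
    by (rule infsumI)
  then show ?thesis
    using LIMSEQ_unique[OF has_sum_int_imp_symmetric_limit[OF has_sum_infsum[OF s]]
        poisson_symmetric[OF f h m]] has_sum_infsum[OF s] by simp
qed

text \<open>This serves both splittings: of the frequency index in the series and of the lattice
  points on the other side of Poisson's formula. The classes are disjoint because \<open>mod\<close>
  recovers the residue, and finitely many unconditional sums over disjoint sets can be
  added.\<close>

lemma has_sum_residue_classes:
  fixes f :: "int \<Rightarrow> 'a::topological_comm_monoid_add"
  assumes q: "q > 0" and v: "\<And>l. l < q \<Longrightarrow> ((\<lambda>m. f (int q * m + int l)) has_sum v l) UNIV"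
  shows "(f has_sum (\<Sum>l<q. v l)) UNIV"
proof -
  let ?B = "\<lambda>l. range (\<lambda>m. int q * m + int l)"
  have "(f has_sum (\<Sum>l<q. v l)) (\<Union>l<q. ?B l)"
  proof (rule sum_has_sum)
    show "(f has_sum v l) (?B l)" if "l \<in> {..<q}" for l
      using v[of l] that q by (subst has_sum_reindex) (auto simp: inj_on_def o_def)
    show "?B l \<inter> ?B l' = {}" if "l \<in> {..<q}" "l' \<in> {..<q}" "l \<noteq> l'" for l l'
    proof (rule equals0I)
      fix k assume k: "k \<in> ?B l \<inter> ?B l'"
      have "k mod int q = int i" if "k \<in> ?B i" "i < q" for i
        using that by auto
      from this[of l] this[of l'] show False using k that by simp
    qed
  qed simp
  moreover have "k \<in> (\<Union>l<q. ?B l)" for k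
  proof (rule UN_I)
    show "nat (k mod int q) \<in> {..<q}" using q by (simp add: nat_less_iff)
    have "k = int q * (k div int q) + int (nat (k mod int q))" using q by simp
    then show "k \<in> ?B (nat (k mod int q))" by blast
  qed
  then have "(\<Union>l<q. ?B l) = UNIV" by blast
  ultimately show ?thesis by simp
qed

section \<open>Lattices of Dirac masses and the Talbot series\<close>

text \<open>This ensures that the \<open>infsum\<close> over a comb is a true limit and not the
  default value 0. Convergence on each test function is not enough, since the limit must itself be a
  distribution. Over a compact set only finitely many masses act, and their number is the constant
  of an estimate of order 0.\<close>

lemma summable_on_dirac:
  assumes fin: "\<And>R. finite {k \<in> A. \<bar>p k\<bar> \<le> R}"
  shows "(\<lambda>k. dirac (p k)) summable_on A"
proof -
  define U where "U \<phi> = (if \<phi> \<in> test_functions then (\<Sum>\<^sub>\<infinity>k\<in>A. \<phi> (p k)) else 0)"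
    for \<phi> :: "real \<Rightarrow> complex"
  have supp: "((\<lambda>k. \<phi> (p k)) has_sum (\<Sum>k\<in>{k \<in> A. \<bar>p k\<bar> \<le> R}. \<phi> (p k))) A"
    if "\<And>x. R < \<bar>x\<bar> \<Longrightarrow> \<phi> x = 0" for \<phi> :: "real \<Rightarrow> complex" and R
    by (rule has_sum_finite_neutralI[OF fin]) (use that in auto)
  have sm: "(\<lambda>k. \<phi> (p k)) summable_on A" if "\<phi> \<in> test_functions" for \<phi>
    using test_function_bounded_support[OF that] supp by (metis has_sum_imp_summable)
  have "U \<in> {u. (\<forall>\<phi>. \<phi> \<notin> test_functions \<longrightarrow> u \<phi> = 0) \<and>
      (\<forall>\<phi>\<in>test_functions. \<forall>\<psi>\<in>test_functions. \<forall>c. u (\<lambda>x. \<phi> x + c * \<psi> x) = u \<phi> + c * u \<psi>) \<and>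
      (\<forall>K. compact K \<longrightarrow> (\<exists>C N. \<forall>\<phi>\<in>test_functions. {x. \<phi> x \<noteq> 0} \<subseteq> K \<longrightarrow>
         norm (u \<phi>) \<le> C * (\<Sum>n\<le>N. SUP x. norm (nth_deriv n \<phi> x))))}"
  proof (intro CollectI conjI ballI allI impI)
    fix \<phi> \<psi> :: "real \<Rightarrow> complex" and c
    assume t: "\<phi> \<in> test_functions" "\<psi> \<in> test_functions"
    show "U (\<lambda>x. \<phi> x + c * \<psi> x) = U \<phi> + c * U \<psi>"
      using t by (simp add: U_def test_functions_lincomb infsum_add sm summable_on_cmult_right
          infsum_cmult_right)
  next
    fix K :: "real set" assume "compact K"
    then have "bounded K" by (rule compact_imp_bounded)
    then obtain R where R: "\<And>x. x \<in> K \<Longrightarrow> \<bar>x\<bar> \<le> R"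
      unfolding bounded_iff by auto
    let ?F = "{k \<in> A. \<bar>p k\<bar> \<le> R}"
    show "\<exists>C N. \<forall>\<phi>\<in>test_functions. {x. \<phi> x \<noteq> 0} \<subseteq> K \<longrightarrow>
         norm (U \<phi>) \<le> C * (\<Sum>n\<le>N. SUP x. norm (nth_deriv n \<phi> x))"
    proof (intro exI[of _ "real (card ?F)"] exI[of _ 0] ballI impI)
      fix \<phi> assume t: "\<phi> \<in> test_functions" and K: "{x. \<phi> x \<noteq> 0} \<subseteq> K"
      have "\<phi> x = 0" if "R < \<bar>x\<bar>" for x
        using K R[of x] that by fastforce
      then have "U \<phi> = (\<Sum>k\<in>?F. \<phi> (p k))"
        unfolding U_def using t by (simp add: infsumI[OF supp])
      also have "norm \<dots> \<le> real (card ?F) * (SUP x. norm (\<phi> x))"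
        by (rule sum_norm_bound) (rule norm_test_function_le[OF t])
      finally show "norm (U \<phi>) \<le> real (card ?F) * (\<Sum>n\<le>0. SUP x. norm (nth_deriv n \<phi> x))"
        by simp
    qed
  qed (simp add: U_def)
  then have "distr_apply (Abs_distribution U) = U"
    by (rule Abs_distribution_inverse)
  then have "((\<lambda>k. dirac (p k)) has_sum Abs_distribution U) A"
    unfolding has_sum_distribution_iff by (auto simp: U_def distr_apply_dirac sm)
  then show ?thesis by (rule has_sum_imp_summable)
qed

section \<open>The series and the combs evaluated on a test function\<close>

lemma distr_apply_infsum_has_sum:
  assumes "f summable_on A" "\<phi> \<in> test_functions"
  shows "((\<lambda>k. distr_apply (f k) \<phi>) has_sum distr_apply (infsum f A) \<phi>) A"
  using has_sum_infsum[OF assms(1)] assms(2) unfolding has_sum_distribution_iff by blast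

lemma distr_apply_talbot_term:
  assumes "\<phi> \<in> test_functions"
  shows "distr_apply (talbot_term M \<tau> k) \<phi>
    = cis (- ((M * of_int k)\<^sup>2 * \<tau>)) * fourier \<phi> (M * of_int k)"
proof -
  have "distr_apply (regular_distr (\<lambda>x. exp (\<i> * complex_of_real (M * of_int k * x)))) \<phi>
      = fourier \<phi> (M * of_int k)"
    using assms by (subst distr_apply_regular_distr) (auto intro!: continuous_intros simp: fourier_def cis_conv_exp)
  then show ?thesis
    by (simp add: talbot_term_def scale_distr.rep_eq cis_conv_exp)
qed

lemma fourier_modulate: "fourier (\<lambda>x. cis (a * x) * f x) \<xi> = fourier f (\<xi> + a)"
  by (simp add: fourier_def distrib_right flip: cis_mult mult.assoc)

lemma gauss_sum_cis:
  "gauss_sum (- int p) (int \<kappa>) q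
    = (\<Sum>l<q. cis (- (2 * pi * real p * (real l)\<^sup>2 / real q)) * cis (2 * pi * real l * real \<kappa> / real q))"
  unfolding gauss_sum_def cis_mult unfolding cis_conv_exp
  by (intro sum.cong refl arg_cong[where f = exp])
    (simp add: add_divide_distrib diff_divide_distrib algebra_simps)

text \<open>Within one class the frequencies have spacing \<open>M * q\<close>, which must equal 2
  pi / h; this fixes \<open>h\<close>. Their common offset \<open>M * l\<close> is what modulating
  \<phi> adds to the frequency.\<close>

lemma has_sum_fourier_residue_class:
  assumes \<phi>: "\<phi> \<in> test_functions" and M: "M > 0" and q: "q > 0"
  shows "((\<lambda>m. fourier \<phi> (M * of_int (int q * m + int l))) has_sum
    (complex_of_real (2 * pi / (M * real q)) * (\<Sum>\<kappa><q. cis (2 * pi * real l * real \<kappa> / real q) *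
      (\<Sum>\<^sub>\<infinity>k\<in>(UNIV::int set). \<phi> (2 * of_int k * pi / M + 2 * pi * real \<kappa> / (M * real q)))))) UNIV"
proof -
  define h where "h = 2 * pi / (M * real q)"
  define f where "f x = cis (M * real l * x) * \<phi> x" for x
  define C where "C \<kappa> = (\<Sum>\<^sub>\<infinity>k\<in>(UNIV::int set). \<phi> (2 * of_int k * pi / M + 2 * pi * real \<kappa> / (M * real q)))"
    for \<kappa>
  have h: "h > 0" using M q by (simp add: h_def)
  obtain R where R: "\<And>x. R < \<bar>x\<bar> \<Longrightarrow> \<phi> x = 0"
    using test_function_bounded_support[OF \<phi>] by blast
  have f_d: "f differentiable (at x)" for x
  proof -
    have "(\<lambda>x. cis (M * real l * x)) differentiable (at x)"
      by (rule differentiableI) (auto intro!: derivative_eq_intros)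
    moreover have "\<phi> differentiable (at x)"
      using test_functions_has_vector_derivative[OF \<phi>] by (rule differentiableI_vector)
    ultimately show ?thesis
      unfolding f_def[abs_def] by (rule differentiable_mult)
  qed
  have F: "fourier f (2 * pi / h * of_int m) = fourier \<phi> (M * of_int (int q * m + int l))" for m
  proof -
    have "2 * pi / h * of_int m + M * real l = M * of_int (int q * m + int l)"
      using M q by (simp add: h_def algebra_simps)
    then show ?thesis
      by (simp only: f_def[abs_def] fourier_modulate)
  qed
  \<comment> \<open>The transform of the modulated function is sampled where that of \<phi> is
    already absolutely summable, so its own decay need not be estimated.\<close>
  have "(\<lambda>k::int. fourier \<phi> (M * of_int k)) summable_on range (\<lambda>m. int q * m + int l)"
    by (rule summable_on_subset[OF abs_summable_summable[OF abs_summable_fourier_lattice]])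
      (use \<phi> M in auto)
  then have "(\<lambda>m. fourier f (2 * pi / h * of_int m)) summable_on UNIV"
    using q unfolding F by (subst (asm) summable_on_reindex) (auto simp: inj_on_def o_def)
  then have P: "((\<lambda>m. fourier f (2 * pi / h * of_int m)) has_sum
      (h * (\<Sum>\<^sub>\<infinity>n\<in>(UNIV::int set). f (h * of_int n)))) UNIV"
    by (intro poisson_summation[where R = R, OF f_d _ h]) (auto simp: f_def R)
  have "((\<lambda>n::int. f (h * of_int n)) has_sum
      (\<Sum>\<kappa><q. cis (2 * pi * real l * real \<kappa> / real q) * C \<kappa>)) UNIV"
  proof (rule has_sum_residue_classes[OF q])
    fix \<kappa> assume "\<kappa> < q"
    let ?p = "\<lambda>k::int. 2 * of_int k * pi / M + 2 * pi * real \<kappa> / (M * real q)"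
    have "finite {k. \<bar>2 * pi * real \<kappa> / (M * real q) + 2 * pi / M * of_int k\<bar> \<le> R}"
      using M by (intro finite_lattice_points) simp
    then have fin: "finite {k. \<bar>?p k\<bar> \<le> R}"
      by (simp add: algebra_simps)
    have "(\<lambda>k. \<phi> (?p k)) summable_on UNIV"
      by (rule has_sum_imp_summable[OF has_sum_finite_neutralI[OF fin]]) (use R in auto)
    then have "((\<lambda>k. cis (2 * pi * real l * real \<kappa> / real q) * \<phi> (?p k)) has_sum
        (cis (2 * pi * real l * real \<kappa> / real q) * C \<kappa>)) UNIV"
      unfolding C_def by (intro has_sum_cmult_right has_sum_infsum)
    moreover have "f (h * of_int (int q * k + int \<kappa>))
        = cis (2 * pi * real l * real \<kappa> / real q) * \<phi> (?p k)" for k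
    proof -
      \<comment> \<open>The first summand is a whole number of turns. On the comb with index
        \<kappa> the modulation is therefore a constant phase and can be taken out of the
        sum.\<close>
      have "M * real l * (h * of_int (int q * k + int \<kappa>))
          = 2 * pi * of_int (int l * k) + 2 * pi * real l * real \<kappa> / real q"
        using M q by (simp add: h_def field_simps)
      moreover have "h * of_int (int q * k + int \<kappa>) = ?p k"
        using M q by (simp add: h_def field_simps)
      ultimately show ?thesis
        unfolding f_def by (simp flip: cis_mult del: of_int_mult)
    qed
    ultimately show "((\<lambda>k. f (h * of_int (int q * k + int \<kappa>))) has_sum
        (cis (2 * pi * real l * real \<kappa> / real q) * C \<kappa>)) UNIV"
      by simp
  qed
  note infsumI[OF this]
  from P[unfolded F, unfolded this, unfolded C_def h_def] show ?thesis .
qed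

theorem proposition3p2:
  fixes M t :: real and p q :: nat
  assumes "M > 0" and "q > 0" and "p < q" and "coprime p q"
    and "t = 2 * pi / M\<^sup>2 * (real p / real q)"
  shows "talbot_term M t summable_on (UNIV :: int set) \<and>
    (\<forall>\<kappa><q. (\<lambda>k. dirac (2 * real_of_int k * pi / M + 2 * pi * real \<kappa> / (M * real q)))
              summable_on (UNIV :: int set)) \<and>
    talbot_restriction M t =
      (\<Sum>\<kappa><q. gauss_sum (- int p) (int \<kappa>) q *\<^sub>C
        (complex_of_real (2 * pi / (M * real q)) *\<^sub>C
          (\<Sum>\<^sub>\<infinity>k\<in>(UNIV :: int set).
            dirac (2 * real_of_int k * pi / M + 2 * pi * real \<kappa> / (M * real q)))))"
    (is "_ \<and> _ \<and> _ = ?rhs")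
proof -
  let ?p = "\<lambda>\<kappa> k. 2 * real_of_int k * pi / M + 2 * pi * real \<kappa> / (M * real q)"
  define h where "h = complex_of_real (2 * pi / (M * real q))"
  define w where "w l = cis (- (2 * pi * real p * (real l)\<^sup>2 / real q))" for l
  define e where "e l \<kappa> = cis (2 * pi * real l * real \<kappa> / real q)" for l \<kappa>
  have comb: "(\<lambda>k. dirac (?p \<kappa> k)) summable_on UNIV" for \<kappa>
  proof (rule summable_on_dirac)
    have "finite {k. \<bar>2 * pi * real \<kappa> / (M * real q) + 2 * pi / M * of_int k\<bar> \<le> R}" for R
      using assms(1) by (intro finite_lattice_points) simp
    then show "finite {k \<in> UNIV. \<bar>?p \<kappa> k\<bar> \<le> R}" for R
      by (simp add: algebra_simps)
  qed
  have phase: "cis (- ((M * of_int (int q * m + int l))\<^sup>2 * t)) = w l" for m l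
  proof -
    \<comment> \<open>Since \<open>M\<^sup>2 * t\<close> is 2 pi p / q, the square and cross terms
      containing \<open>q * m\<close> yield whole turns, and only the term in \<open>l\<close>
      squared remains.\<close>
    have "- ((M * of_int (int q * m + int l))\<^sup>2 * t)
        = 2 * pi * of_int (- (int p * (int q * m\<^sup>2 + 2 * m * int l)))
          + - (2 * pi * real p * (real l)\<^sup>2 / real q)"
      using assms(1,2) by (simp add: assms(5) field_simps power2_eq_square)
    then show ?thesis
      by (simp only: w_def cis_mult[symmetric] cis_multiple_2pi[OF Ints_of_int] mult_1_left)
  qed
  \<comment> \<open>The candidate limit is already a distribution, so testing against each \<phi>
    proves summability of the series and identifies its sum at once.\<close>
  have "(talbot_term M t has_sum ?rhs) UNIV"
    unfolding has_sum_distribution_iff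
  proof
    fix \<phi> assume \<phi>: "\<phi> \<in> test_functions"
    define C where "C \<kappa> = (\<Sum>\<^sub>\<infinity>k\<in>(UNIV::int set). \<phi> (?p \<kappa> k))" for \<kappa>
    have C: "distr_apply (\<Sum>\<^sub>\<infinity>k\<in>UNIV. dirac (?p \<kappa> k)) \<phi> = C \<kappa>" for \<kappa>
      using distr_apply_infsum_has_sum[OF comb \<phi>, THEN infsumI] \<phi>
      by (simp add: distr_apply_dirac C_def)
    have "((\<lambda>k. distr_apply (talbot_term M t k) \<phi>) has_sum
        (\<Sum>l<q. w l * (h * (\<Sum>\<kappa><q. e l \<kappa> * C \<kappa>)))) UNIV"
    proof (rule has_sum_residue_classes[OF assms(2)])
      show "((\<lambda>m. distr_apply (talbot_term M t (int q * m + int l)) \<phi>) has_sum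
          (w l * (h * (\<Sum>\<kappa><q. e l \<kappa> * C \<kappa>)))) UNIV" for l
        unfolding distr_apply_talbot_term[OF \<phi>] phase h_def e_def C_def
        by (intro has_sum_cmult_right has_sum_fourier_residue_class \<phi> assms(1,2))
    qed
    also have "(\<Sum>l<q. w l * (h * (\<Sum>\<kappa><q. e l \<kappa> * C \<kappa>))) = (\<Sum>\<kappa><q. (\<Sum>l<q. w l * e l \<kappa>) * (h * C \<kappa>))"
      unfolding sum_distrib_left sum_distrib_right by (subst sum.swap) (simp add: mult_ac)
    also have "\<dots> = distr_apply ?rhs \<phi>"
      by (simp add: distr_apply_sum scale_distr.rep_eq C gauss_sum_cis h_def w_def e_def)
    finally show "((\<lambda>k. distr_apply (talbot_term M t k) \<phi>) has_sum distr_apply ?rhs \<phi>) UNIV" .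
  qed
  then show ?thesis
    using comb by (auto simp: talbot_restriction_def has_sum_imp_summable infsumI)
qed

end
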